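(* Let $\Bbbk$ be a field and let $\mathbb{R}$ denote the $\Bbbk$-algebra generated by $y_1,y_2,x_1,x_2$ subject to the relations $$x_2x_1=-x_1x_2,\quad y_2y_1=-y_1y_2,\quad y_1x_2=x_1y_2,\quad y_2x_1=x_2y_1,$$ $$y_1x_1=x_1y_1+x_2y_1+x_1y_2,\quad y_2x_2=-x_2y_1-x_1y_2+x_2y_2.$$ Let $S\subset\Bbbk\{y_1,y_2,x_1,x_2\}$ be the set consisting of the six polynomials $$x_2x_1+x_1x_2,\quad y_2y_1+y_1y_2,\quad x_1y_2-y_1x_2,\quad x_2y_1-y_2x_1,$$ $$x_1y_1+y_2x_1+y_1x_2-y_1x_1,\quad x_2y_2-y_2x_1-y_1x_2-y_2x_2.$$ Then, with respect to the degree lexicographic order with $y_1\prec y_2\prec x_1\prec x_2$, the set $S$ is a Gröbner-Shirshov basis of the ideal $\mathrm{Id}(S)$, which is the ideal of defining relations of this algebra, i.e. $\mathbb{R}=\Bbbk\{y_1,y_2,x_1,x_2\}/\mathrm{Id}(S)$.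
   Context: Here $\mathbb{R}$ is the name of the algebra just defined, not the field of real numbers. Let $X=\{y_1,y_2,x_1,x_2\}$, let $X^*$ be the free monoid of words in $X$, and let $\Bbbk\{X\}$ be the free associative unital $\Bbbk$-algebra on $X$ (noncommutative polynomials). $\mathrm{Id}(S)$ denotes the two-sided ideal of $\Bbbk\{X\}$ generated by $S$. The degree lexicographic order $\prec$ on $X^*$ compares words first by length and then, for equal length, lexicographically from left to right with $y_1\prec y_2\prec x_1\prec x_2$. For a nonzero $f\in\Bbbk\{X\}$, $\overline{f}$ denotes its leading (i.e. $\prec$-largest) word; $f$ is monic if the coefficient of $\overline{f}$ is $1$. For monic $f,g$: (i) if $w=\overline{f}a=b\overline{g}$ with $a,b\in X^*$ and $|\overline{f}|+|\overline{g}|>|w|$, then $(f,g)_w:=fa-bg$ is the intersection composition; (ii) if $w=\overline{f}=a\overline{g}b$ with $a,b\in X^*$, then $(f,g)_w:=f-agb$ is the inclusion composition. A composition $(f,g)_w$ is trivial modulo $S$ if $(f,g)_w=\sum_i\alpha_i a_is_ib_i$ (finite sum) with $\alpha_i\in\Bbbk$, $a_i,b_i\in X^*$, $s_i\in S$ and $a_i\overline{s_i}b_i\prec w$ for all $i$. A nonempty set $S$ of monic polynomials is a Gröbner-Shirshov basis of $\mathrm{Id}(S)$ if every composition $(f,g)_w$ with $f,g\in S$ is trivial modulo $S$. *)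

theory Defs
  imports "HOL-Library.Poly_Mapping" "HOL-Algebra.QuotRing" "HOL-Algebra.Module"
begin

(* Words are lists. The free monoid structure on lists, written additively, is what makes the
   convolution product of Poly_Mapping the product of noncommutative polynomials. *)
instantiation list :: (type) monoid_add
begin

definition zero_list :: "'a list" where "zero_list = []"

definition plus_list :: "'a list \<Rightarrow> 'a list \<Rightarrow> 'a list" where "plus_list u v = u @ v"

instance by standard (simp_all add: zero_list_def plus_list_def)

end

type_synonym ('a, 'k) ncpoly = "'a list \<Rightarrow>\<^sub>0 'k"

definition wrd :: "'a list \<Rightarrow> ('a, 'k::field) ncpoly" where
  "wrd u = Poly_Mapping.single u 1"

definition scale :: "'k::field \<Rightarrow> ('a, 'k) ncpoly \<Rightarrow> ('a, 'k) ncpoly" where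
  "scale c f = Poly_Mapping.single [] c * f"

definition free_algebra :: "('k::field, ('a, 'k) ncpoly) module" where
  "free_algebra =
    \<lparr>carrier = UNIV, mult = (*), one = 1, zero = 0, add = (+), smult = scale\<rparr>"

lemma ring_free_algebra: "ring (free_algebra :: ('k::field, ('a, 'k) ncpoly) module)"
proof (rule ringI)
  show "abelian_group (free_algebra :: ('k, ('a, 'k) ncpoly) module)"
  proof (rule abelian_groupI)
    fix x :: "('a, 'k) ncpoly"
    show "\<exists>y\<in>carrier (free_algebra :: ('k, ('a, 'k) ncpoly) module).
        y \<oplus>\<^bsub>free_algebra\<^esub> x = \<zero>\<^bsub>free_algebra\<^esub>"
      by (rule bexI[of _ "- x"]) (simp_all add: free_algebra_def)
  qed (simp_all add: free_algebra_def ac_simps)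
  show "Group.monoid (free_algebra :: ('k, ('a, 'k) ncpoly) module)"
    by (rule monoidI) (simp_all add: free_algebra_def mult.assoc)
qed (simp_all add: free_algebra_def algebra_simps)

(* The two-sided ideal generated by S. It is automatically closed under scale, since
   scale c f is a product in the free algebra. *)
definition Id_gen :: "('a, 'k::field) ncpoly set \<Rightarrow> ('a, 'k) ncpoly set" where
  "Id_gen S = Idl\<^bsub>free_algebra\<^esub> S"

(* FactRing forgets scalars; scalar multiplication of cosets is c (f + I) = c f + I. *)
definition quotient_algebra ::
  "('k, 'b) module \<Rightarrow> 'b set \<Rightarrow> ('k, 'b set) module" (infixl \<open>'/'/\<^sub>a\<close> 65) where
  "A //\<^sub>a I = ring.extend (A Quot I)
     (module.fields (\<lambda>c C. \<Union>f\<in>C. I +>\<^bsub>A\<^esub> (c \<odot>\<^bsub>A\<^esub> f)))"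

(* The algebra with the given defining relations; a pair (l, r) stands for l = r. *)
definition presented_algebra ::
  "(('a, 'k::field) ncpoly \<times> ('a, 'k) ncpoly) set \<Rightarrow> ('k, ('a, 'k) ncpoly set) module" where
  "presented_algebra Rel = free_algebra //\<^sub>a Id_gen {l - r |l r. (l, r) \<in> Rel}"

definition deglex_less :: "'a::linorder list \<Rightarrow> 'a list \<Rightarrow> bool" (infix \<open>\<prec>\<close> 50) where
  "u \<prec> v \<longleftrightarrow> (u, v) \<in> lenlex {(a, b). a < b}"

(* Meaningful for f \<noteq> 0 only. *)
definition lead_word :: "('a::linorder, 'k::field) ncpoly \<Rightarrow> 'a list" where
  "lead_word f =
    (THE w. w \<in> Poly_Mapping.keys f \<and> (\<forall>v\<in>Poly_Mapping.keys f. v \<noteq> w \<longrightarrow> v \<prec> w))"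

definition is_monic :: "('a::linorder, 'k::field) ncpoly \<Rightarrow> bool" where
  "is_monic f \<longleftrightarrow> f \<noteq> 0 \<and> Poly_Mapping.lookup f (lead_word f) = 1"

(* composition f g w h: the polynomial h is a composition of f and g with respect to w. *)
inductive composition ::
  "('a::linorder, 'k::field) ncpoly \<Rightarrow> ('a, 'k) ncpoly \<Rightarrow> 'a list \<Rightarrow> ('a, 'k) ncpoly \<Rightarrow> bool" where
  intersection:
    "w = lead_word f @ a \<Longrightarrow> w = b @ lead_word g \<Longrightarrow>
     length (lead_word f) + length (lead_word g) > length w \<Longrightarrow>
     composition f g w (f * wrd a - wrd b * g)"
| inclusion:
    "w = lead_word f \<Longrightarrow> w = a @ lead_word g @ b \<Longrightarrow>
     composition f g w (f - wrd a * g * wrd b)"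

definition trivial_modulo ::
  "('a::linorder, 'k::field) ncpoly set \<Rightarrow> 'a list \<Rightarrow> ('a, 'k) ncpoly \<Rightarrow> bool" where
  "trivial_modulo S w h \<longleftrightarrow>
    (\<exists>(n::nat) \<alpha> a s b.
       h = (\<Sum>i<n. scale (\<alpha> i) (wrd (a i) * s i * wrd (b i))) \<and>
       (\<forall>i<n. s i \<in> S \<and> a i @ lead_word (s i) @ b i \<prec> w))"

(* S is a Groebner-Shirshov basis of the ideal Id_gen S. *)
definition groebner_shirshov_basis :: "('a::linorder, 'k::field) ncpoly set \<Rightarrow> bool" where
  "groebner_shirshov_basis S \<longleftrightarrow>
    S \<noteq> {} \<and> (\<forall>f\<in>S. is_monic f) \<and>
    (\<forall>f\<in>S. \<forall>g\<in>S. \<forall>w h. composition f g w h \<longrightarrow> trivial_modulo S w h)"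

datatype letter = Y1 | Y2 | X1 | X2

instantiation letter :: linorder
begin

fun rank_letter :: "letter \<Rightarrow> nat" where
  "rank_letter Y1 = 0"
| "rank_letter Y2 = 1"
| "rank_letter X1 = 2"
| "rank_letter X2 = 3"

definition less_eq_letter :: "letter \<Rightarrow> letter \<Rightarrow> bool" where
  "less_eq_letter a b \<longleftrightarrow> rank_letter a \<le> rank_letter b"

definition less_letter :: "letter \<Rightarrow> letter \<Rightarrow> bool" where
  "less_letter a b \<longleftrightarrow> rank_letter a < rank_letter b"

instance
proof
  fix a b :: letter
  show "a \<le> b \<Longrightarrow> b \<le> a \<Longrightarrow> a = b"
    by (cases a; cases b) (simp_all add: less_eq_letter_def)
qed (auto simp: less_eq_letter_def less_letter_def)

end

abbreviation y\<^sub>1 :: "(letter, 'k::field) ncpoly" where "y\<^sub>1 \<equiv> wrd [Y1]"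
abbreviation y\<^sub>2 :: "(letter, 'k::field) ncpoly" where "y\<^sub>2 \<equiv> wrd [Y2]"
abbreviation x\<^sub>1 :: "(letter, 'k::field) ncpoly" where "x\<^sub>1 \<equiv> wrd [X1]"
abbreviation x\<^sub>2 :: "(letter, 'k::field) ncpoly" where "x\<^sub>2 \<equiv> wrd [X2]"

definition R_relations ::
  "((letter, 'k::field) ncpoly \<times> (letter, 'k) ncpoly) set" where
  "R_relations =
    {(x\<^sub>2 * x\<^sub>1, - (x\<^sub>1 * x\<^sub>2)),
     (y\<^sub>2 * y\<^sub>1, - (y\<^sub>1 * y\<^sub>2)),
     (y\<^sub>1 * x\<^sub>2, x\<^sub>1 * y\<^sub>2),
     (y\<^sub>2 * x\<^sub>1, x\<^sub>2 * y\<^sub>1),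
     (y\<^sub>1 * x\<^sub>1, x\<^sub>1 * y\<^sub>1 + x\<^sub>2 * y\<^sub>1 + x\<^sub>1 * y\<^sub>2),
     (y\<^sub>2 * x\<^sub>2, - (x\<^sub>2 * y\<^sub>1) - x\<^sub>1 * y\<^sub>2 + x\<^sub>2 * y\<^sub>2)}"

definition R_algebra :: "('k::field, (letter, 'k) ncpoly set) module" where
  "R_algebra = presented_algebra R_relations"

definition R_basis :: "(letter, 'k::field) ncpoly set" where
  "R_basis =
    {x\<^sub>2 * x\<^sub>1 + x\<^sub>1 * x\<^sub>2,
     y\<^sub>2 * y\<^sub>1 + y\<^sub>1 * y\<^sub>2,
     x\<^sub>1 * y\<^sub>2 - y\<^sub>1 * x\<^sub>2,
     x\<^sub>2 * y\<^sub>1 - y\<^sub>2 * x\<^sub>1,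
     x\<^sub>1 * y\<^sub>1 + y\<^sub>2 * x\<^sub>1 + y\<^sub>1 * x\<^sub>2 - y\<^sub>1 * x\<^sub>1,
     x\<^sub>2 * y\<^sub>2 - y\<^sub>2 * x\<^sub>1 - y\<^sub>1 * x\<^sub>2 - y\<^sub>2 * x\<^sub>2}"

end

theory Submission
  imports Defs
begin

text \<open>
  All six leading words have length two and they are pairwise distinct. An overlap of two such
  words either is complete, in which case both polynomials coincide and the composition is zero, or
  it consists of one letter and gives a word of length three. The leading words
  \<open>x\<^sub>2x\<^sub>1, y\<^sub>2y\<^sub>1, x\<^sub>1y\<^sub>2, x\<^sub>2y\<^sub>1, x\<^sub>1y\<^sub>1, x\<^sub>2y\<^sub>2\<close> overlap in exactly four words,
  \<open>x\<^sub>2x\<^sub>1y\<^sub>2, x\<^sub>2x\<^sub>1y\<^sub>1, x\<^sub>1y\<^sub>2y\<^sub>1, x\<^sub>2y\<^sub>2y\<^sub>1\<close>.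
  Rewriting each of them from the left and from the right leads to the same normal form, namely
  \<open>y\<^sub>2x\<^sub>1x\<^sub>2, y\<^sub>1x\<^sub>1x\<^sub>2, y\<^sub>1y\<^sub>2x\<^sub>1, y\<^sub>1y\<^sub>2x\<^sub>2\<close> respectively; recording the rewriting
  steps presents the composition as a combination of multiples \<open>x s\<close> and \<open>s x\<close> of basis
  elements \<open>s\<close> by letters \<open>x\<close>, with coefficients \<open>1\<close> and \<open>-1\<close>. The criterion
  \<open>quadratic_groebner_shirshov\<close> reduces the theorem to these four identities.

  The ideals agree because, up to signs, four of the defining relations are basis elements, and
  the other two differ from basis elements by the sum of the third and the fourth one, which
  exchanges \<open>x\<^sub>1y\<^sub>2\<close> with \<open>y\<^sub>1x\<^sub>2\<close> and \<open>x\<^sub>2y\<^sub>1\<close> with \<open>y\<^sub>2x\<^sub>1\<close>.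
\<close>

section \<open>Words and leading words\<close>

lemma wrd_mult: "wrd u * wrd v = (wrd (u @ v) :: ('a, 'k::field) ncpoly)"
  by (simp add: wrd_def mult_single plus_list_def)

lemma wrd_Nil: "wrd [] = (1 :: ('a, 'k::field) ncpoly)"
  by (simp add: wrd_def zero_list_def[symmetric])

lemma lookup_wrd:
  "Poly_Mapping.lookup (wrd u :: ('a, 'k::field) ncpoly) v = (if u = v then 1 else 0)"
  by (simp add: wrd_def lookup_single when_def)

lemma deglex_asym: "u \<prec> v \<Longrightarrow> \<not> v \<prec> (u :: 'a::linorder list)"
  unfolding deglex_less_def by (rule asymD[OF asym_lenlex]) (auto intro: asymI)

lemma lead_wordI:
  fixes f :: "('a::linorder, 'k::field) ncpoly"
  assumes "Poly_Mapping.lookup f w = 1"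
    and "\<And>v. Poly_Mapping.lookup f v \<noteq> 0 \<Longrightarrow> v \<noteq> w \<Longrightarrow> v \<prec> w"
  shows "lead_word f = w" and "is_monic f"
proof -
  show lead: "lead_word f = w"
    unfolding lead_word_def
  proof (rule the_equality)
    show "w \<in> Poly_Mapping.keys f \<and> (\<forall>v\<in>Poly_Mapping.keys f. v \<noteq> w \<longrightarrow> v \<prec> w)"
      using assms by (auto simp: in_keys_iff)
  next
    fix u
    assume "u \<in> Poly_Mapping.keys f \<and> (\<forall>v\<in>Poly_Mapping.keys f. v \<noteq> u \<longrightarrow> v \<prec> u)"
    then show "u = w"
      using assms deglex_asym by (metis in_keys_iff zero_neq_one)
  qed
  show "is_monic f"
    unfolding is_monic_def lead using assms(1) by auto
qed

section \<open>Compositions with respect to quadratic leading words\<close>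

lemma trivial_zero: "trivial_modulo S w 0"
  unfolding trivial_modulo_def by (rule exI[of _ 0]) simp

lemma trivial_add_multiple:
  assumes "trivial_modulo S w h" and "t \<in> S" and "c @ lead_word t @ d \<prec> w"
  shows "trivial_modulo S w (h + scale \<beta> (wrd c * t * wrd d))"
proof -
  obtain n :: nat and \<alpha> a s b where
    h: "h = (\<Sum>i<n. scale (\<alpha> i) (wrd (a i) * s i * wrd (b i)))"
    and less: "\<forall>i<n. s i \<in> S \<and> a i @ lead_word (s i) @ b i \<prec> w"
    using assms(1) unfolding trivial_modulo_def by blast
  show ?thesis
    unfolding trivial_modulo_def
    by (rule exI[of _ "Suc n"], rule exI[of _ "\<alpha>(n := \<beta>)"], rule exI[of _ "a(n := c)"],
        rule exI[of _ "s(n := t)"], rule exI[of _ "b(n := d)"])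
      (use assms less in \<open>auto simp: h less_Suc_eq\<close>)
qed

text \<open>
  Induction on the number of multiples in the second representation spares concatenating two
  indexed families.
\<close>

lemma trivial_add:
  assumes "trivial_modulo S w g" and "trivial_modulo S w h"
  shows "trivial_modulo S w (g + h)"
proof -
  obtain n :: nat and \<alpha> a s b where
    h: "h = (\<Sum>i<n. scale (\<alpha> i) (wrd (a i) * s i * wrd (b i)))"
    and less: "\<forall>i<n. s i \<in> S \<and> a i @ lead_word (s i) @ b i \<prec> w"
    using assms(2) unfolding trivial_modulo_def by blast
  have "m \<le> n \<Longrightarrow> trivial_modulo S w (g + (\<Sum>i<m. scale (\<alpha> i) (wrd (a i) * s i * wrd (b i))))" for m
    by (induction m)
      (use assms(1) less in \<open>auto simp: add.assoc[symmetric] intro!: trivial_add_multiple\<close>)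
  then show ?thesis
    unfolding h by blast
qed

lemma trivial_uminus:
  assumes "trivial_modulo S w h"
  shows "trivial_modulo S w (- h)"
proof -
  obtain n :: nat and \<alpha> a s b where
    h: "h = (\<Sum>i<n. scale (\<alpha> i) (wrd (a i) * s i * wrd (b i)))"
    and less: "\<forall>i<n. s i \<in> S \<and> a i @ lead_word (s i) @ b i \<prec> w"
    using assms unfolding trivial_modulo_def by blast
  have "- h = (\<Sum>i<n. scale (- \<alpha> i) (wrd (a i) * s i * wrd (b i)))"
    by (simp add: h scale_def single_uminus sum_negf)
  with less show ?thesis
    unfolding trivial_modulo_def
    by (intro exI[of _ n] exI[of _ "\<lambda>i. - \<alpha> i"] exI[of _ a] exI[of _ s] exI[of _ b] conjI)
qed

lemma trivial_diff:
  assumes "trivial_modulo S w g" and "trivial_modulo S w h"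
  shows "trivial_modulo S w (g - h)"
  using trivial_add[OF assms(1) trivial_uminus[OF assms(2)]] by simp

lemma trivial_multiple:
  assumes "s \<in> S" and "a @ lead_word s @ b \<prec> w"
  shows "trivial_modulo S w (wrd a * s * wrd b)"
  using trivial_add_multiple[OF trivial_zero assms, of 1]
  by (simp add: scale_def zero_list_def[symmetric])

lemma trivial_left_multiple:
  assumes "s \<in> S" and "a @ lead_word s \<prec> w"
  shows "trivial_modulo S w (wrd a * s)"
  using trivial_multiple[of s S a "[]" w] assms by (simp add: wrd_Nil)

lemma trivial_right_multiple:
  assumes "s \<in> S" and "lead_word s @ b \<prec> w"
  shows "trivial_modulo S w (s * wrd b)"
  using trivial_multiple[of s S "[]" b w] assms by (simp add: wrd_Nil)

text \<open>
  Two words of length two overlap in both letters or in one. The former, like an inclusion, forces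
  the words and hence by injectivity the polynomials to be equal, so that the composition is zero.
\<close>

lemma quadratic_groebner_shirshov:
  fixes S :: "('a::linorder, 'k::field) ncpoly set"
  assumes nonempty: "S \<noteq> {}"
    and monic: "\<And>f. f \<in> S \<Longrightarrow> is_monic f"
    and quadratic: "\<And>f. f \<in> S \<Longrightarrow> length (lead_word f) = 2"
    and inj: "inj_on lead_word S"
    and overlap: "\<And>f g p q r. f \<in> S \<Longrightarrow> g \<in> S \<Longrightarrow> lead_word f = [p, q] \<Longrightarrow> lead_word g = [q, r]
      \<Longrightarrow> trivial_modulo S [p, q, r] (f * wrd [r] - wrd [p] * g)"
  shows "groebner_shirshov_basis S"
proof -
  have "trivial_modulo S w h" if f: "f \<in> S" and g: "g \<in> S" and "composition f g w h" for f g w h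
    using that(3)
  proof cases
    case (intersection a b)
    obtain p q where lf: "lead_word f = [p, q]"
      using quadratic[OF f] by (auto simp: length_Suc_conv numeral_2_eq_2)
    obtain q' r where lg: "lead_word g = [q', r]"
      using quadratic[OF g] by (auto simp: length_Suc_conv numeral_2_eq_2)
    have "length a \<le> 1"
      using intersection lf lg by simp
    then consider "a = []" | c where "a = [c]"
      by (cases a) auto
    then show ?thesis
    proof cases
      case 1
      then have "b = []" "lead_word f = lead_word g"
        using intersection lf lg by (auto simp: Cons_eq_append_conv)
      moreover from this have "f = g"
        using inj f g by (auto dest: inj_onD)
      ultimately show ?thesis
        using intersection 1 by (simp add: wrd_Nil trivial_zero)
    next
      case 2
      then have "a = [r]" "b = [p]" "q' = q"
        using intersection lf lg by (auto simp: Cons_eq_append_conv)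
      then show ?thesis
        using overlap[OF f g lf] lg intersection lf by simp
    qed
  next
    case (inclusion a b)
    have "length a + length b = 0"
      using arg_cong[OF inclusion(3), of length] inclusion(2) quadratic[OF f] quadratic[OF g] by simp
    then have "a = []" "b = []" "lead_word f = lead_word g"
      using inclusion by auto
    moreover from this have "f = g"
      using inj f g by (auto dest: inj_onD)
    ultimately show ?thesis
      using inclusion by (simp add: wrd_Nil trivial_zero)
  qed
  then show ?thesis
    unfolding groebner_shirshov_basis_def using nonempty monic by blast
qed

section \<open>The four overlaps\<close>

text \<open>Each basis element is named after its leading word.\<close>

definition s_x2x1 :: "(letter, 'k::field) ncpoly" where
  "s_x2x1 = x\<^sub>2 * x\<^sub>1 + x\<^sub>1 * x\<^sub>2"

definition s_y2y1 :: "(letter, 'k::field) ncpoly" where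
  "s_y2y1 = y\<^sub>2 * y\<^sub>1 + y\<^sub>1 * y\<^sub>2"

definition s_x1y2 :: "(letter, 'k::field) ncpoly" where
  "s_x1y2 = x\<^sub>1 * y\<^sub>2 - y\<^sub>1 * x\<^sub>2"

definition s_x2y1 :: "(letter, 'k::field) ncpoly" where
  "s_x2y1 = x\<^sub>2 * y\<^sub>1 - y\<^sub>2 * x\<^sub>1"

definition s_x1y1 :: "(letter, 'k::field) ncpoly" where
  "s_x1y1 = x\<^sub>1 * y\<^sub>1 + y\<^sub>2 * x\<^sub>1 + y\<^sub>1 * x\<^sub>2 - y\<^sub>1 * x\<^sub>1"

definition s_x2y2 :: "(letter, 'k::field) ncpoly" where
  "s_x2y2 = x\<^sub>2 * y\<^sub>2 - y\<^sub>2 * x\<^sub>1 - y\<^sub>1 * x\<^sub>2 - y\<^sub>2 * x\<^sub>2"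

lemmas s_defs = s_x2x1_def s_y2y1_def s_x1y2_def s_x2y1_def s_x1y1_def s_x2y2_def

lemma R_basis_eq: "R_basis = {s_x2x1, s_y2y1, s_x1y2, s_x2y1, s_x1y1, s_x2y2}"
  by (simp add: R_basis_def s_defs)

lemmas order_simps = deglex_less_def Cons_lenlex_iff less_letter_def

lemma lead_words:
  "lead_word s_x2x1 = [X2, X1]" "lead_word s_y2y1 = [Y2, Y1]" "lead_word s_x1y2 = [X1, Y2]"
  "lead_word s_x2y1 = [X2, Y1]" "lead_word s_x1y1 = [X1, Y1]" "lead_word s_x2y2 = [X2, Y2]"
  and monic_basis:
  "is_monic s_x2x1" "is_monic s_y2y1" "is_monic s_x1y2"
  "is_monic s_x2y1" "is_monic s_x1y1" "is_monic s_x2y2"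
proof -
  note lookup_simps = s_defs wrd_mult lookup_add lookup_minus lookup_wrd order_simps
  show "lead_word s_x2x1 = [X2, X1]" "is_monic s_x2x1"
    by (rule lead_wordI[where w = "[X2, X1]"]; auto simp: lookup_simps split: if_splits)+
  show "lead_word s_y2y1 = [Y2, Y1]" "is_monic s_y2y1"
    by (rule lead_wordI[where w = "[Y2, Y1]"]; auto simp: lookup_simps split: if_splits)+
  show "lead_word s_x1y2 = [X1, Y2]" "is_monic s_x1y2"
    by (rule lead_wordI[where w = "[X1, Y2]"]; auto simp: lookup_simps split: if_splits)+
  show "lead_word s_x2y1 = [X2, Y1]" "is_monic s_x2y1"
    by (rule lead_wordI[where w = "[X2, Y1]"]; auto simp: lookup_simps split: if_splits)+
  show "lead_word s_x1y1 = [X1, Y1]" "is_monic s_x1y1"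
    by (rule lead_wordI[where w = "[X1, Y1]"]; auto simp: lookup_simps split: if_splits)+
  show "lead_word s_x2y2 = [X2, Y2]" "is_monic s_x2y2"
    by (rule lead_wordI[where w = "[X2, Y2]"]; auto simp: lookup_simps split: if_splits)+
qed

text \<open>
  Replacing a leading word inside a longer word subtracts a multiple of the basis element. The two
  terms of each difference on the left start the two ways of rewriting the overlap word; the
  summands on the right are the later rewriting steps on both sides, where steps common to both
  sides and the equal normal forms have cancelled.
\<close>

lemma composition_identities:
  "s_x2x1 * y\<^sub>2 - x\<^sub>2 * s_x1y2 =
    x\<^sub>1 * s_x2y2 + s_x1y2 * x\<^sub>1 + y\<^sub>1 * s_x2x1 + s_x1y1 * x\<^sub>2 + s_x1y2 * x\<^sub>2 + s_x2y1 * x\<^sub>2"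
  "s_x2x1 * y\<^sub>1 - x\<^sub>2 * s_x1y1 =
    x\<^sub>1 * s_x2y1 + s_x1y2 * x\<^sub>1 - s_x2y2 * x\<^sub>1 - y\<^sub>2 * s_x2x1 - s_x2y1 * x\<^sub>2 + s_x2y1 * x\<^sub>1"
  "s_x1y2 * y\<^sub>1 - x\<^sub>1 * s_y2y1 =
    y\<^sub>2 * s_x1y2 - s_x1y1 * y\<^sub>2 - y\<^sub>1 * s_x2y1 + s_y2y1 * x\<^sub>2 + y\<^sub>1 * s_x2y2 - y\<^sub>1 * s_x1y2"
  "s_x2y2 * y\<^sub>1 - x\<^sub>2 * s_y2y1 =
    - (y\<^sub>2 * s_x1y1) - s_y2y1 * x\<^sub>1 - y\<^sub>1 * s_x2y1 - y\<^sub>2 * s_x2y1 - s_x2y1 * y\<^sub>2 - y\<^sub>2 * s_x1y2"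
  by (simp_all add: s_defs distrib_left distrib_right left_diff_distrib right_diff_distrib wrd_mult)

lemma overlaps_trivial:
  "trivial_modulo R_basis [X2, X1, Y2] (s_x2x1 * y\<^sub>2 - x\<^sub>2 * s_x1y2)"
  "trivial_modulo R_basis [X2, X1, Y1] (s_x2x1 * y\<^sub>1 - x\<^sub>2 * s_x1y1)"
  "trivial_modulo R_basis [X1, Y2, Y1] (s_x1y2 * y\<^sub>1 - x\<^sub>1 * s_y2y1)"
  "trivial_modulo R_basis [X2, Y2, Y1] (s_x2y2 * y\<^sub>1 - x\<^sub>2 * s_y2y1)"
  unfolding composition_identities
  by (intro trivial_add trivial_diff trivial_uminus trivial_left_multiple trivial_right_multiple;
      simp add: R_basis_eq lead_words order_simps)+

lemma R_basis_groebner_shirshov: "groebner_shirshov_basis (R_basis :: (letter, 'k::field) ncpoly set)"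
proof (rule quadratic_groebner_shirshov)
  show "R_basis \<noteq> {}"
    by (simp add: R_basis_eq)
  show "is_monic f" if "f \<in> R_basis" for f :: "(letter, 'k) ncpoly"
    using that by (auto simp: R_basis_eq monic_basis)
  show "length (lead_word f) = 2" if "f \<in> R_basis" for f :: "(letter, 'k) ncpoly"
    using that by (auto simp: R_basis_eq lead_words)
  show "inj_on lead_word (R_basis :: (letter, 'k) ncpoly set)"
    by (auto simp: R_basis_eq lead_words)
  show "trivial_modulo R_basis [p, q, r] (f * wrd [r] - wrd [p] * g)"
    if "f \<in> R_basis" "g \<in> R_basis" "lead_word f = [p, q]" "lead_word g = [q, r]"
    for f g :: "(letter, 'k) ncpoly" and p q r
    using that overlaps_trivial by (auto simp: R_basis_eq lead_words)
qed

section \<open>Equality of the ideals\<close>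

lemma Id_gen_ideal: "ideal (Id_gen S) free_algebra"
  unfolding Id_gen_def
  by (rule ring.genideal_ideal[OF ring_free_algebra]) (simp add: free_algebra_def)

lemma Id_gen_incl: "f \<in> S \<Longrightarrow> f \<in> Id_gen S"
  using ring.genideal_self[OF ring_free_algebra, of S]
  by (auto simp: Id_gen_def free_algebra_def)

lemma Id_gen_add: "f \<in> Id_gen S \<Longrightarrow> g \<in> Id_gen S \<Longrightarrow> f + g \<in> Id_gen S"
  using additive_subgroup.a_closed[OF ideal.axioms(1)[OF Id_gen_ideal], of f S g]
  by (simp add: free_algebra_def)

lemma Id_gen_uminus: "f \<in> Id_gen S \<Longrightarrow> - f \<in> Id_gen S"
  using ideal.I_l_closed[OF Id_gen_ideal, of f S "- 1"]
  by (simp add: free_algebra_def)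

lemma Id_gen_diff: "f \<in> Id_gen S \<Longrightarrow> g \<in> Id_gen S \<Longrightarrow> f - g \<in> Id_gen S"
  using Id_gen_add[OF _ Id_gen_uminus, of f S g] by simp

lemma Id_gen_least: "T \<subseteq> Id_gen S \<Longrightarrow> Id_gen T \<subseteq> Id_gen S"
  using ring.genideal_minimal[OF ring_free_algebra Id_gen_ideal] by (simp add: Id_gen_def)

text \<open>
  Expressing the defining relations in the basis elements leaves only signed sums, so that membership
  in either ideal follows from closure under addition and negation.
\<close>

lemma relators_eq:
  "{l - r |l r. (l, r) \<in> R_relations} = {s_x2x1, s_y2y1, - s_x1y2, - s_x2y1,
     - s_x1y1 - (s_x1y2 + s_x2y1), - s_x2y2 + (s_x1y2 + s_x2y1)}"
proof -
  have "{l - r |l r. (l, r) \<in> R_relations} = (\<lambda>(l, r). l - r) ` R_relations"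
    by force
  also have "\<dots> = {s_x2x1, s_y2y1, - s_x1y2, - s_x2y1,
     - s_x1y1 - (s_x1y2 + s_x2y1), - s_x2y2 + (s_x1y2 + s_x2y1)}"
    by (simp add: R_relations_def s_defs algebra_simps)
  finally show ?thesis .
qed

lemma Id_gen_relators: "Id_gen {l - r |l r. (l, r) \<in> R_relations} = Id_gen R_basis"
proof (unfold relators_eq, rule antisym; rule Id_gen_least)
  let ?T = "{s_x2x1, s_y2y1, - s_x1y2, - s_x2y1,
     - s_x1y1 - (s_x1y2 + s_x2y1), - s_x2y2 + (s_x1y2 + s_x2y1)}"
  show "?T \<subseteq> Id_gen R_basis"
    by (auto intro!: Id_gen_add Id_gen_diff Id_gen_uminus intro: Id_gen_incl simp: R_basis_eq)
  have gens: "f \<in> Id_gen ?T" if "f \<in> ?T" for f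
    using that by (rule Id_gen_incl)
  have "s_x1y2 \<in> Id_gen ?T" and "s_x2y1 \<in> Id_gen ?T"
    using Id_gen_uminus[OF gens[of "- s_x1y2"]] Id_gen_uminus[OF gens[of "- s_x2y1"]] by simp_all
  moreover from this have sum: "s_x1y2 + s_x2y1 \<in> Id_gen ?T"
    by (rule Id_gen_add)
  moreover have "s_x1y1 \<in> Id_gen ?T"
    using Id_gen_uminus[OF Id_gen_add[OF gens[of "- s_x1y1 - (s_x1y2 + s_x2y1)"] sum]] by simp
  moreover have "s_x2y2 \<in> Id_gen ?T"
    using Id_gen_add[OF Id_gen_uminus[OF gens[of "- s_x2y2 + (s_x1y2 + s_x2y1)"]] sum] by simp
  ultimately show "R_basis \<subseteq> Id_gen ?T"
    using gens[of s_x2x1] gens[of s_y2y1] by (simp add: R_basis_eq)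
qed

theorem mainTheorem9:
  shows "groebner_shirshov_basis (R_basis :: (letter, 'k::field) ncpoly set)
    \<and> Id_gen {l - r |l r. (l, r) \<in> (R_relations :: ((letter, 'k) ncpoly \<times> (letter, 'k) ncpoly) set)}
        = Id_gen R_basis
    \<and> (R_algebra :: ('k, (letter, 'k) ncpoly set) module) = free_algebra //\<^sub>a Id_gen R_basis"
  by (simp add: R_basis_groebner_shirshov Id_gen_relators R_algebra_def presented_algebra_def)

end
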